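(* Let $\mathbf{C}$ be a firm braided monoidal category with tensor unit $I$ and left unitor $\lambda$. The idempotent subunits in $\mathbf{C}$ form a meet-semilattice under the usual order of subobjects, with meet of $s\colon S\rightarrowtail I$ and $t\colon T\rightarrowtail I$ given by $\lambda_I\circ(s\otimes t)\colon S\otimes T\rightarrowtail I$, and with largest element $\mathrm{id}_I$. In particular, for idempotent subunits $s,t$, the morphism $s$ factors through $t$ if and only if there is an isomorphism $h\colon S\to S\otimes T$ with $\lambda_I\circ(s\otimes t)\circ h=s$.
   Context: A subunit in a monoidal category with tensor unit $I$ is a subobject of $I$, i.e. an equivalence class of monomorphisms $s\colon S\rightarrowtail I$, where two monomorphisms are identified if they factor through each other. The usual order of subobjects is: $s\le t$ when $s$ factors through $t$. A subunit $s\colon S\rightarrowtail I$ is idempotent when $s\otimes\mathrm{id}_S\colon S\otimes S\to I\otimes S$ is an isomorphism. A monoidal category is firm when for any two subunits $s\colon S\rightarrowtail I$ and $t\colon T\rightarrowtail I$ the morphism $t\otimes\mathrm{id}_S$ is monic. *)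

theory Defs
  imports "HOL-Algebra.Lattice"
begin

section \<open>Categories\<close>

text \<open>Composition is written in the usual applicative order, \<open>g \<cdot> f\<close> for ``\<open>g\<close> after \<open>f\<close>''. Since HOL
  functions are total, the operations are also applied outside their intended domain (for instance to
  non-composable pairs); nothing is assumed about their values there.\<close>

record ('o, 'm) category =
  obj :: "'o set"
  mor :: "'m set"
  src :: "'m \<Rightarrow> 'o"
  tgt :: "'m \<Rightarrow> 'o"
  ident :: "'o \<Rightarrow> 'm"
  comp :: "'m \<Rightarrow> 'm \<Rightarrow> 'm"  (infixr \<open>\<cdot>\<index>\<close> 65)

definition hom :: "('o, 'm, 'e) category_scheme \<Rightarrow> 'o \<Rightarrow> 'o \<Rightarrow> 'm set" where
  "hom C A B = {f \<in> mor C. src C f = A \<and> tgt C f = B}"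

locale category =
  fixes C :: "('o, 'm, 'e) category_scheme" (structure)
  assumes src_obj: "f \<in> mor C \<Longrightarrow> src C f \<in> obj C"
    and tgt_obj: "f \<in> mor C \<Longrightarrow> tgt C f \<in> obj C"
    and ident_hom: "A \<in> obj C \<Longrightarrow> ident C A \<in> hom C A A"
    and comp_hom: "\<lbrakk>f \<in> hom C A B; g \<in> hom C B D\<rbrakk> \<Longrightarrow> g \<cdot> f \<in> hom C A D"
    and comp_assoc: "\<lbrakk>f \<in> hom C A B; g \<in> hom C B D; h \<in> hom C D E\<rbrakk>
          \<Longrightarrow> (h \<cdot> g) \<cdot> f = h \<cdot> (g \<cdot> f)"
    and comp_ident_left: "f \<in> hom C A B \<Longrightarrow> ident C B \<cdot> f = f"
    and comp_ident_right: "f \<in> hom C A B \<Longrightarrow> f \<cdot> ident C A = f"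

definition inverse_mors :: "('o, 'm, 'e) category_scheme \<Rightarrow> 'm \<Rightarrow> 'm \<Rightarrow> bool" where
  "inverse_mors C f g \<longleftrightarrow> f \<in> mor C \<and> g \<in> hom C (tgt C f) (src C f)
     \<and> g \<cdot>\<^bsub>C\<^esub> f = ident C (src C f) \<and> f \<cdot>\<^bsub>C\<^esub> g = ident C (tgt C f)"

definition is_iso :: "('o, 'm, 'e) category_scheme \<Rightarrow> 'm \<Rightarrow> bool" where
  "is_iso C f \<longleftrightarrow> (\<exists>g. inverse_mors C f g)"

definition inv_mor :: "('o, 'm, 'e) category_scheme \<Rightarrow> 'm \<Rightarrow> 'm" where
  "inv_mor C f = (THE g. inverse_mors C f g)"

definition monic :: "('o, 'm, 'e) category_scheme \<Rightarrow> 'm \<Rightarrow> bool" where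
  "monic C f \<longleftrightarrow> f \<in> mor C \<and>
     (\<forall>A. \<forall>g \<in> hom C A (src C f). \<forall>h \<in> hom C A (src C f). f \<cdot>\<^bsub>C\<^esub> g = f \<cdot>\<^bsub>C\<^esub> h \<longrightarrow> g = h)"

section \<open>Subobjects\<close>

definition factors_through :: "('o, 'm, 'e) category_scheme \<Rightarrow> 'm \<Rightarrow> 'm \<Rightarrow> bool" where
  "factors_through C s t \<longleftrightarrow> (\<exists>m \<in> hom C (src C s) (src C t). t \<cdot>\<^bsub>C\<^esub> m = s)"

definition monos_into :: "('o, 'm, 'e) category_scheme \<Rightarrow> 'o \<Rightarrow> 'm set" where
  "monos_into C A = {s. monic C s \<and> tgt C s = A}"

definition subobj_rel :: "('o, 'm, 'e) category_scheme \<Rightarrow> 'o \<Rightarrow> ('m \<times> 'm) set" where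
  "subobj_rel C A = {(s, t). s \<in> monos_into C A \<and> t \<in> monos_into C A
     \<and> factors_through C s t \<and> factors_through C t s}"

definition subobjects :: "('o, 'm, 'e) category_scheme \<Rightarrow> 'o \<Rightarrow> 'm set set" where
  "subobjects C A = monos_into C A // subobj_rel C A"

definition subobj_class :: "('o, 'm, 'e) category_scheme \<Rightarrow> 'm \<Rightarrow> 'm set" where
  "subobj_class C s = subobj_rel C (tgt C s) `` {s}"

definition subobj_le :: "('o, 'm, 'e) category_scheme \<Rightarrow> 'm set \<Rightarrow> 'm set \<Rightarrow> bool" where
  "subobj_le C X Y \<longleftrightarrow> (\<exists>s \<in> X. \<exists>t \<in> Y. factors_through C s t)"

section \<open>Braided monoidal categories\<close>

record ('o, 'm) monoidal_category = "('o, 'm) category" +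
  tensor_obj :: "'o \<Rightarrow> 'o \<Rightarrow> 'o"  (infixl \<open>\<odot>\<index>\<close> 70)
  tensor_mor :: "'m \<Rightarrow> 'm \<Rightarrow> 'm"  (infixl \<open>\<otimes>\<index>\<close> 70)
  unit_obj :: "'o"  (\<open>\<one>\<index>\<close>)
  associator :: "'o \<Rightarrow> 'o \<Rightarrow> 'o \<Rightarrow> 'm"
  left_unitor :: "'o \<Rightarrow> 'm"
  right_unitor :: "'o \<Rightarrow> 'm"

locale monoidal_category = category C
  for C :: "('o, 'm, 'e) monoidal_category_scheme" (structure) +
  assumes unit_obj: "\<one> \<in> obj C"
    and tensor_obj: "\<lbrakk>A \<in> obj C; B \<in> obj C\<rbrakk> \<Longrightarrow> A \<odot> B \<in> obj C"
    and tensor_hom: "\<lbrakk>f \<in> hom C A A'; g \<in> hom C B B'\<rbrakk> \<Longrightarrow> f \<otimes> g \<in> hom C (A \<odot> B) (A' \<odot> B')"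
    and tensor_ident: "\<lbrakk>A \<in> obj C; B \<in> obj C\<rbrakk>
          \<Longrightarrow> ident C A \<otimes> ident C B = ident C (A \<odot> B)"
    and interchange: "\<lbrakk>f \<in> hom C A A'; f' \<in> hom C A' A''; g \<in> hom C B B'; g' \<in> hom C B' B''\<rbrakk>
          \<Longrightarrow> (f' \<cdot> f) \<otimes> (g' \<cdot> g) = (f' \<otimes> g') \<cdot> (f \<otimes> g)"
    and associator_hom: "\<lbrakk>A \<in> obj C; B \<in> obj C; D \<in> obj C\<rbrakk>
          \<Longrightarrow> associator C A B D \<in> hom C ((A \<odot> B) \<odot> D) (A \<odot> (B \<odot> D))"
    and associator_iso: "\<lbrakk>A \<in> obj C; B \<in> obj C; D \<in> obj C\<rbrakk> \<Longrightarrow> is_iso C (associator C A B D)"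
    and associator_natural: "\<lbrakk>f \<in> hom C A A'; g \<in> hom C B B'; h \<in> hom C D D'\<rbrakk>
          \<Longrightarrow> associator C A' B' D' \<cdot> ((f \<otimes> g) \<otimes> h) = (f \<otimes> (g \<otimes> h)) \<cdot> associator C A B D"
    and left_unitor_hom: "A \<in> obj C \<Longrightarrow> left_unitor C A \<in> hom C (\<one> \<odot> A) A"
    and left_unitor_iso: "A \<in> obj C \<Longrightarrow> is_iso C (left_unitor C A)"
    and left_unitor_natural: "f \<in> hom C A B
          \<Longrightarrow> left_unitor C B \<cdot> (ident C \<one> \<otimes> f) = f \<cdot> left_unitor C A"
    and right_unitor_hom: "A \<in> obj C \<Longrightarrow> right_unitor C A \<in> hom C (A \<odot> \<one>) A"
    and right_unitor_iso: "A \<in> obj C \<Longrightarrow> is_iso C (right_unitor C A)"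
    and right_unitor_natural: "f \<in> hom C A B
          \<Longrightarrow> right_unitor C B \<cdot> (f \<otimes> ident C \<one>) = f \<cdot> right_unitor C A"
    and pentagon: "\<lbrakk>A \<in> obj C; B \<in> obj C; D \<in> obj C; E \<in> obj C\<rbrakk>
          \<Longrightarrow> (ident C A \<otimes> associator C B D E) \<cdot> associator C A (B \<odot> D) E
                \<cdot> (associator C A B D \<otimes> ident C E)
            = associator C A B (D \<odot> E) \<cdot> associator C (A \<odot> B) D E"
    and triangle: "\<lbrakk>A \<in> obj C; B \<in> obj C\<rbrakk>
          \<Longrightarrow> (ident C A \<otimes> left_unitor C B) \<cdot> associator C A \<one> B = right_unitor C A \<otimes> ident C B"

record ('o, 'm) braided_monoidal_category = "('o, 'm) monoidal_category" +
  braiding :: "'o \<Rightarrow> 'o \<Rightarrow> 'm"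

locale braided_monoidal_category = monoidal_category C
  for C :: "('o, 'm, 'e) braided_monoidal_category_scheme" (structure) +
  assumes braiding_hom: "\<lbrakk>A \<in> obj C; B \<in> obj C\<rbrakk> \<Longrightarrow> braiding C A B \<in> hom C (A \<odot> B) (B \<odot> A)"
    and braiding_iso: "\<lbrakk>A \<in> obj C; B \<in> obj C\<rbrakk> \<Longrightarrow> is_iso C (braiding C A B)"
    and braiding_natural: "\<lbrakk>f \<in> hom C A A'; g \<in> hom C B B'\<rbrakk>
          \<Longrightarrow> braiding C A' B' \<cdot> (f \<otimes> g) = (g \<otimes> f) \<cdot> braiding C A B"
    and hexagon: "\<lbrakk>A \<in> obj C; B \<in> obj C; D \<in> obj C\<rbrakk>
          \<Longrightarrow> associator C B D A \<cdot> braiding C A (B \<odot> D) \<cdot> associator C A B D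
            = (ident C B \<otimes> braiding C A D) \<cdot> associator C B A D \<cdot> (braiding C A B \<otimes> ident C D)"
    and hexagon_inv: "\<lbrakk>A \<in> obj C; B \<in> obj C; D \<in> obj C\<rbrakk>
          \<Longrightarrow> inv_mor C (associator C D A B) \<cdot> braiding C (A \<odot> B) D \<cdot> inv_mor C (associator C A B D)
            = (braiding C A D \<otimes> ident C B) \<cdot> inv_mor C (associator C A D B)
                \<cdot> (ident C A \<otimes> braiding C B D)"

section \<open>Subunits\<close>

text \<open>Firmness and idempotence of subunits are stated on representing monomorphisms; they do not depend
  on the choice of representative.\<close>

definition firm :: "('o, 'm, 'e) monoidal_category_scheme \<Rightarrow> bool" where
  "firm C \<longleftrightarrow> (\<forall>s \<in> monos_into C \<one>\<^bsub>C\<^esub>. \<forall>t \<in> monos_into C \<one>\<^bsub>C\<^esub>. monic C (t \<otimes>\<^bsub>C\<^esub> ident C (src C s)))"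

definition idempotent_subunit :: "('o, 'm, 'e) monoidal_category_scheme \<Rightarrow> 'm \<Rightarrow> bool" where
  "idempotent_subunit C s \<longleftrightarrow> s \<in> monos_into C \<one>\<^bsub>C\<^esub> \<and> is_iso C (s \<otimes>\<^bsub>C\<^esub> ident C (src C s))"

definition idempotent_subunits :: "('o, 'm, 'e) monoidal_category_scheme \<Rightarrow> 'm set set" where
  "idempotent_subunits C = {X \<in> subobjects C \<one>\<^bsub>C\<^esub>. \<exists>s \<in> X. idempotent_subunit C s}"

definition ISub :: "('o, 'm, 'e) monoidal_category_scheme \<Rightarrow> 'm set gorder" where
  "ISub C = \<lparr>carrier = idempotent_subunits C, eq = (=), le = subobj_le C\<rparr>"

end

theory Submission
  imports Defs
begin

text \<open>Write \<open>s \<and> t\<close> for \<open>\<lambda>\<^sub>I \<cdot> (s \<otimes> t)\<close>, and say that a subunit \<open>s\<close> absorbs an object \<open>X\<close> when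
  \<open>s \<otimes> id\<^sub>X\<close> is invertible; idempotence says that \<open>s\<close> absorbs its own domain \<open>S\<close>.

  Naturality of the left unitor gives \<open>s \<and> t = t \<cdot> \<lambda>\<^sub>T \<cdot> (s \<otimes> id\<^sub>T)\<close> (\<open>subunit_meet_eq\<close>). Hence
  \<open>s \<and> t\<close> lies below \<open>t\<close>, and by firmness it is a composite of monomorphisms. It is idempotent
  because absorption passes from \<open>X\<close> to \<open>X \<otimes> Y\<close> by associativity and along isomorphisms of the
  object: both \<open>s\<close> and \<open>t\<close> absorb \<open>S \<otimes> T \<cong> T \<otimes> S\<close>, and if both absorb \<open>X\<close>, then so does
  \<open>s \<and> t\<close>.

  The inequality \<open>s \<and> t \<le> s\<close> is the delicate one: it would be the mirror image of
  \<open>s \<and> t \<le> t\<close> if \<open>\<lambda>\<^sub>I\<close> were replaced by the right unitor at \<open>I\<close>. That the two unitors agree there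
  is a coherence theorem; idempotence gives a direct argument instead. Indeed,
  invertibility of \<open>s \<otimes> id\<^sub>S\<close> makes \<open>id\<^sub>I \<otimes> s\<close> factor through
  \<open>s \<otimes> s\<close>, the braiding carries this over to \<open>s \<otimes> id\<^sub>I\<close>, and therefore
  \<open>s \<and> t \<le> s \<and> s \<le> s\<close> (\<open>subunit_meet_le_left\<close>).

  If an idempotent \<open>u\<close> factors as \<open>s \<cdot> m\<close> and as \<open>t \<cdot> n\<close>, then \<open>u \<and> u = (s \<and> t) \<cdot> (m \<otimes> n)\<close>, while
  \<open>u \<and> u\<close> is \<open>u\<close> precomposed with an isomorphism; so \<open>u \<le> s \<and> t\<close> (\<open>le_subunit_meet\<close>). The
  criterion for \<open>s \<le> t\<close> is the usual one, \<open>s \<le> t\<close> iff \<open>s\<close> and \<open>s \<and> t\<close> are the same subobject.\<close>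

section \<open>Arrow calculus\<close>

context category
begin

text \<open>The category axioms are restated with domains and codomains as equations, so that the simplifier
  can discharge typing conditions and normalises composites to right-nested form.\<close>

lemma comp_arr [simp]:
  assumes "f \<in> mor C" "g \<in> mor C" "src C g = tgt C f"
  shows "g \<cdot> f \<in> mor C" "src C (g \<cdot> f) = src C f" "tgt C (g \<cdot> f) = tgt C g"
  using comp_hom[of f "src C f" "tgt C f" g "tgt C g"] assms by (simp_all add: hom_def)

lemma ident_arr [simp]:
  assumes "A \<in> obj C"
  shows "ident C A \<in> mor C" "src C (ident C A) = A" "tgt C (ident C A) = A"
  using ident_hom[OF assms] by (simp_all add: hom_def)

lemma arr_assoc [simp]:
  "\<lbrakk>f \<in> mor C; g \<in> mor C; h \<in> mor C; src C g = tgt C f; src C h = tgt C g\<rbrakk>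
    \<Longrightarrow> (h \<cdot> g) \<cdot> f = h \<cdot> (g \<cdot> f)"
  by (rule comp_assoc) (auto simp: hom_def)

lemma arr_ident [simp]:
  assumes "f \<in> mor C"
  shows "tgt C f = A \<Longrightarrow> ident C A \<cdot> f = f" "src C f = A \<Longrightarrow> f \<cdot> ident C A = f"
  using comp_ident_left[of f] comp_ident_right[of f] assms by (auto simp: hom_def)

lemmas arr_obj [simp] = src_obj tgt_obj

lemma iso_arr: "is_iso C f \<Longrightarrow> f \<in> mor C"
  by (auto simp: is_iso_def inverse_mors_def)

lemma isoE:
  assumes "is_iso C f"
  obtains g where "g \<in> mor C" "src C g = tgt C f" "tgt C g = src C f"
    "g \<cdot> f = ident C (src C f)" "f \<cdot> g = ident C (tgt C f)"
  using assms by (auto simp: is_iso_def inverse_mors_def hom_def)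

lemma isoI:
  assumes "f \<in> mor C" "g \<in> mor C" "src C g = tgt C f" "tgt C g = src C f"
    "g \<cdot> f = ident C (src C f)" "f \<cdot> g = ident C (tgt C f)"
  shows "is_iso C f"
  using assms by (auto simp: is_iso_def inverse_mors_def hom_def)

lemma iso_ident: "A \<in> obj C \<Longrightarrow> is_iso C (ident C A)"
  by (rule isoI[where g = "ident C A"]) simp_all

lemma iso_comp:
  assumes f: "is_iso C f" and g: "is_iso C g" and fg: "src C g = tgt C f"
  shows "is_iso C (g \<cdot> f)"
proof -
  obtain f' where f': "f' \<in> mor C" "src C f' = tgt C f" "tgt C f' = src C f"
    "f' \<cdot> f = ident C (src C f)" "f \<cdot> f' = ident C (tgt C f)" by (rule isoE[OF f])
  obtain g' where g': "g' \<in> mor C" "src C g' = tgt C g" "tgt C g' = src C g"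
    "g' \<cdot> g = ident C (src C g)" "g \<cdot> g' = ident C (tgt C g)" by (rule isoE[OF g])
  note arr = iso_arr[OF f] iso_arr[OF g] fg f'(1-3) g'(1-3)
  have "g' \<cdot> (g \<cdot> f) = (g' \<cdot> g) \<cdot> f"
    using arr by simp
  then have "g' \<cdot> (g \<cdot> f) = f"
    using arr g'(4) by simp
  moreover have "f \<cdot> (f' \<cdot> g') = (f \<cdot> f') \<cdot> g'"
    using arr by simp
  then have "f \<cdot> (f' \<cdot> g') = g'"
    using arr f'(5) by simp
  ultimately show ?thesis
    using arr f' g' by (intro isoI[where g = "f' \<cdot> g'"]) simp_all
qed

lemma iso_inverse:
  assumes f: "is_iso C f" "src C f = A" "tgt C f = B"
  obtains g where "is_iso C g" "src C g = B" "tgt C g = A"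
    "g \<cdot> f = ident C A" "f \<cdot> g = ident C B"
proof -
  obtain g where g: "g \<in> mor C" "src C g = tgt C f" "tgt C g = src C f"
    "g \<cdot> f = ident C (src C f)" "f \<cdot> g = ident C (tgt C f)" by (rule isoE[OF f(1)])
  then have "is_iso C g"
    using iso_arr[OF f(1)] by (intro isoI[where g = f]) simp_all
  then show thesis
    using g f(2,3) that by simp
qed

text \<open>If three sides \<open>f\<close>, \<open>a\<close>, \<open>b\<close> of a commuting square are invertible, then so is the fourth,
  \<open>g = a \<cdot> f \<cdot> b\<^sup>-\<^sup>1\<close>. This transports invertibility along the components of a natural isomorphism;
  the next lemma does so in the opposite direction.\<close>

lemma iso_square_right:
  assumes f: "is_iso C f" and a: "is_iso C a" and b: "is_iso C b"
    and g: "g \<in> mor C" "src C g = tgt C b" and fa: "src C a = tgt C f"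
    and fb: "src C f = src C b"
    and eq: "a \<cdot> f = g \<cdot> b"
  shows "is_iso C g"
proof -
  obtain b' where b': "is_iso C b'" "src C b' = tgt C b" "tgt C b' = src C b"
    "b \<cdot> b' = ident C (tgt C b)" by (rule iso_inverse[OF b refl refl])
  note arr = iso_arr[OF f] iso_arr[OF a] iso_arr[OF b] iso_arr[OF b'(1)]
  have "g = (g \<cdot> b) \<cdot> b'"
    using arr g b' by simp
  also have "\<dots> = (a \<cdot> f) \<cdot> b'" by (simp add: eq)
  finally show ?thesis
    using arr b' a f fa fb by (simp add: iso_comp)
qed

lemma iso_square_left:
  assumes g: "is_iso C g" and a: "is_iso C a" and b: "is_iso C b"
    and f: "f \<in> mor C" "tgt C f = src C a" and gb: "src C g = tgt C b"
    and eq: "a \<cdot> f = g \<cdot> b"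
  shows "is_iso C f"
proof -
  obtain a' where a': "is_iso C a'" "src C a' = tgt C a" "tgt C a' = src C a"
    "a' \<cdot> a = ident C (src C a)" by (rule iso_inverse[OF a refl refl])
  note arr = iso_arr[OF g] iso_arr[OF a] iso_arr[OF b] iso_arr[OF a'(1)]
  have tgt: "tgt C g = tgt C a"
    using arg_cong[OF eq, of "tgt C"] arr f gb by simp
  have "f = (a' \<cdot> a) \<cdot> f"
    using arr f a' by simp
  also have "\<dots> = a' \<cdot> (a \<cdot> f)"
    using arr f a'(2,3) by simp
  also have "a \<cdot> f = g \<cdot> b" by (fact eq)
  finally show ?thesis
    using a' arr tgt gb g b by (simp add: iso_comp)
qed

lemma monic_arr: "monic C f \<Longrightarrow> f \<in> mor C"
  by (simp add: monic_def)

lemma monic_cancel: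
  "\<lbrakk>monic C f; g \<in> mor C; h \<in> mor C; src C g = src C h; tgt C g = src C f; tgt C h = src C f;
    f \<cdot> g = f \<cdot> h\<rbrakk> \<Longrightarrow> g = h"
  by (auto simp: monic_def hom_def)

lemma monic_comp:
  assumes f: "monic C f" and g: "monic C g" and fg: "src C g = tgt C f"
  shows "monic C (g \<cdot> f)"
  unfolding monic_def
proof (intro conjI allI ballI impI)
  note arr = monic_arr[OF f] monic_arr[OF g]
  show "g \<cdot> f \<in> mor C" using arr fg by simp
  fix A x y
  assume x: "x \<in> hom C A (src C (g \<cdot> f))" and y: "y \<in> hom C A (src C (g \<cdot> f))"
    and eq: "(g \<cdot> f) \<cdot> x = (g \<cdot> f) \<cdot> y"
  note xy = x[unfolded hom_def] y[unfolded hom_def]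
  have "g \<cdot> (f \<cdot> x) = g \<cdot> (f \<cdot> y)"
    using eq arr fg xy by simp
  then have "f \<cdot> x = f \<cdot> y"
    using arr fg xy by - (rule monic_cancel[OF g], simp_all)
  then show "x = y"
    using arr fg xy by - (rule monic_cancel[OF f], simp_all)
qed

lemma iso_monic:
  assumes f: "is_iso C f"
  shows "monic C f"
  unfolding monic_def
proof (intro conjI allI ballI impI)
  obtain g where g: "g \<in> mor C" "src C g = tgt C f" "tgt C g = src C f"
    "g \<cdot> f = ident C (src C f)" by (rule isoE[OF f])
  note arr = iso_arr[OF f]
  show "f \<in> mor C" by (fact arr)
  fix A x y
  assume x: "x \<in> hom C A (src C f)" and y: "y \<in> hom C A (src C f)" and eq: "f \<cdot> x = f \<cdot> y"
  note xy = x[unfolded hom_def] y[unfolded hom_def]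
  have "x = (g \<cdot> f) \<cdot> x" using xy g by simp
  also have "\<dots> = g \<cdot> (f \<cdot> x)" using xy g(1-3) arr by simp
  also have "\<dots> = g \<cdot> (f \<cdot> y)" by (simp only: eq)
  also have "\<dots> = (g \<cdot> f) \<cdot> y" using xy g(1-3) arr by simp
  also have "\<dots> = y" using xy g by simp
  finally show "x = y" .
qed

lemma factors_throughI:
  "\<lbrakk>m \<in> mor C; src C m = src C s; tgt C m = src C t; t \<cdot> m = s\<rbrakk> \<Longrightarrow> factors_through C s t"
  by (auto simp: factors_through_def hom_def)

lemma factors_throughE:
  assumes "factors_through C s t"
  obtains m where "m \<in> mor C" "src C m = src C s" "tgt C m = src C t" "t \<cdot> m = s"
  using assms by (auto simp: factors_through_def hom_def)

lemma factors_through_refl: "s \<in> mor C \<Longrightarrow> factors_through C s s"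
  by (rule factors_throughI[where m = "ident C (src C s)"]) simp_all

lemma factors_through_trans:
  assumes "factors_through C r s" "factors_through C s t" "t \<in> mor C"
  shows "factors_through C r t"
proof -
  obtain m where m: "m \<in> mor C" "src C m = src C r" "tgt C m = src C s" "s \<cdot> m = r"
    by (rule factors_throughE[OF assms(1)])
  obtain n where n: "n \<in> mor C" "src C n = src C s" "tgt C n = src C t" "t \<cdot> n = s"
    by (rule factors_throughE[OF assms(2)])
  have "t \<cdot> (n \<cdot> m) = (t \<cdot> n) \<cdot> m"
    using m(1-3) n(1-3) assms(3) by simp
  then show ?thesis
    using m n by (intro factors_throughI[where m = "n \<cdot> m"]) simp_all
qed

text \<open>Both composites of the two comparison maps are cancelled to identities by the monomorphisms.\<close>

lemma mutual_factors_iso: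
  assumes s: "monic C s" and t: "monic C t"
    and st: "factors_through C s t" and ts: "factors_through C t s"
  obtains h where "is_iso C h" "src C h = src C s" "tgt C h = src C t" "t \<cdot> h = s"
proof -
  obtain m where m: "m \<in> mor C" "src C m = src C s" "tgt C m = src C t" "t \<cdot> m = s"
    by (rule factors_throughE[OF st])
  obtain n where n: "n \<in> mor C" "src C n = src C t" "tgt C n = src C s" "s \<cdot> n = t"
    by (rule factors_throughE[OF ts])
  note arr = monic_arr[OF s] monic_arr[OF t]
  have "s \<cdot> (n \<cdot> m) = (s \<cdot> n) \<cdot> m" using m(1-3) n(1-3) arr by simp
  then have "s \<cdot> (n \<cdot> m) = s" by (simp only: m(4) n(4))
  then have "n \<cdot> m = ident C (src C s)"
    using m(1-3) n(1-3) arr by - (rule monic_cancel[OF s], simp_all)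
  moreover have "t \<cdot> (m \<cdot> n) = (t \<cdot> m) \<cdot> n" using m(1-3) n(1-3) arr by simp
  then have "t \<cdot> (m \<cdot> n) = t" by (simp only: m(4) n(4))
  then have "m \<cdot> n = ident C (src C t)"
    using m(1-3) n(1-3) arr by - (rule monic_cancel[OF t], simp_all)
  ultimately have "is_iso C m"
    using m(1-3) n(1-3) by (intro isoI[where g = n]) simp_all
  then show thesis using m that by blast
qed

section \<open>The poset of subobjects\<close>

lemma monos_intoD:
  assumes "s \<in> monos_into C A"
  shows "monic C s" "s \<in> mor C" "tgt C s = A"
  using assms by (auto simp: monos_into_def monic_arr)

lemma equiv_subobj_rel: "equiv (monos_into C A) (subobj_rel C A)"
proof (rule equivI)
  show "refl_on (monos_into C A) (subobj_rel C A)"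
    by (auto simp: refl_on_def subobj_rel_def monos_intoD intro: factors_through_refl)
  show "sym (subobj_rel C A)"
    by (auto simp: sym_def subobj_rel_def)
  show "trans (subobj_rel C A)"
    by (auto simp: trans_def subobj_rel_def intro: factors_through_trans monos_intoD(2))
qed (auto simp: subobj_rel_def)

lemma mem_subobj_class_iff:
  assumes "s \<in> monos_into C A"
  shows "x \<in> subobj_class C s
    \<longleftrightarrow> x \<in> monos_into C A \<and> factors_through C s x \<and> factors_through C x s"
  using assms monos_intoD(3)[OF assms] by (auto simp: subobj_class_def subobj_rel_def)

text \<open>The order of subobjects asks for some pair of comparable representatives; any other pair then
  compares as well, since representatives of one class factor through each other.\<close>

lemma subobj_class_le_iff:
  assumes s: "s \<in> monos_into C A" and t: "t \<in> monos_into C A"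
  shows "subobj_le C (subobj_class C s) (subobj_class C t) \<longleftrightarrow> factors_through C s t"
proof
  assume "subobj_le C (subobj_class C s) (subobj_class C t)"
  then obtain x y where x: "x \<in> subobj_class C s" and y: "y \<in> subobj_class C t"
      and xy: "factors_through C x y"
    by (auto simp: subobj_le_def)
  have "factors_through C s x" "factors_through C y t" "y \<in> mor C" "t \<in> mor C"
    using x y s t by (auto simp: mem_subobj_class_iff intro: monos_intoD(2))
  then show "factors_through C s t"
    using xy factors_through_trans by metis
next
  assume "factors_through C s t"
  then show "subobj_le C (subobj_class C s) (subobj_class C t)"
    using s t unfolding subobj_le_def
    by (intro bexI[of _ s] bexI[of _ t])
      (auto simp: mem_subobj_class_iff intro: factors_through_refl monos_intoD(2))
qed

lemma subobj_class_eqI: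
  assumes s: "s \<in> monos_into C A" and t: "t \<in> monos_into C A"
    and "factors_through C s t" "factors_through C t s"
  shows "subobj_class C s = subobj_class C t"
proof -
  have "(s, t) \<in> subobj_rel C A"
    using assms by (simp add: subobj_rel_def)
  then show ?thesis
    using equiv_class_eq[OF equiv_subobj_rel] s t by (simp add: subobj_class_def monos_intoD)
qed

end

section \<open>Tensor products of subunits\<close>

context monoidal_category
begin

lemma tensor_arr [simp]:
  assumes "f \<in> mor C" "g \<in> mor C"
  shows "f \<otimes> g \<in> mor C" "src C (f \<otimes> g) = src C f \<odot> src C g"
    "tgt C (f \<otimes> g) = tgt C f \<odot> tgt C g"
  using tensor_hom[of f "src C f" "tgt C f" g "src C g" "tgt C g"] assms
  by (simp_all add: hom_def)

lemmas obj_simps [simp] = unit_obj tensor_obj tensor_ident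

lemma left_unitor_arr [simp]:
  assumes "A \<in> obj C"
  shows "left_unitor C A \<in> mor C" "src C (left_unitor C A) = \<one> \<odot> A" "tgt C (left_unitor C A) = A"
  using left_unitor_hom[OF assms] by (simp_all add: hom_def)

lemma associator_arr [simp]:
  assumes "A \<in> obj C" "B \<in> obj C" "D \<in> obj C"
  shows "associator C A B D \<in> mor C" "src C (associator C A B D) = (A \<odot> B) \<odot> D"
    "tgt C (associator C A B D) = A \<odot> (B \<odot> D)"
  using associator_hom[OF assms] by (simp_all add: hom_def)

lemma tensor_comp:
  "\<lbrakk>f \<in> mor C; f' \<in> mor C; g \<in> mor C; g' \<in> mor C; src C f' = tgt C f; src C g' = tgt C g\<rbrakk>
    \<Longrightarrow> (f' \<otimes> g') \<cdot> (f \<otimes> g) = (f' \<cdot> f) \<otimes> (g' \<cdot> g)"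
  by (rule interchange[symmetric]) (auto simp: hom_def)

lemma iso_tensor:
  assumes f: "is_iso C f" and g: "is_iso C g"
  shows "is_iso C (f \<otimes> g)"
proof -
  obtain f' where f': "f' \<in> mor C" "src C f' = tgt C f" "tgt C f' = src C f"
    "f' \<cdot> f = ident C (src C f)" "f \<cdot> f' = ident C (tgt C f)" by (rule isoE[OF f])
  obtain g' where g': "g' \<in> mor C" "src C g' = tgt C g" "tgt C g' = src C g"
    "g' \<cdot> g = ident C (src C g)" "g \<cdot> g' = ident C (tgt C g)" by (rule isoE[OF g])
  note arr = iso_arr[OF f] iso_arr[OF g]
  show ?thesis
    using arr f' g' by (intro isoI[where g = "f' \<otimes> g'"]) (simp_all add: tensor_comp)
qed

text \<open>Absorption depends on the object only up to isomorphism: \<open>id \<otimes> e\<close> conjugates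
  \<open>s \<otimes> id\<^sub>X\<close> into \<open>s \<otimes> id\<close> at the codomain of \<open>e\<close>.\<close>

lemma tensor_ident_iso_transfer:
  assumes s: "s \<in> mor C" and X: "is_iso C (s \<otimes> ident C X)" "X \<in> obj C"
    and e: "is_iso C e" "src C e = X"
  shows "is_iso C (s \<otimes> ident C (tgt C e))"
proof (rule iso_square_right[OF X(1)])
  note arr = iso_arr[OF e(1)]
  show "is_iso C (ident C (tgt C s) \<otimes> e)" "is_iso C (ident C (src C s) \<otimes> e)"
    using s e by (simp_all add: iso_tensor iso_ident)
  show "(ident C (tgt C s) \<otimes> e) \<cdot> (s \<otimes> ident C X)
      = (s \<otimes> ident C (tgt C e)) \<cdot> (ident C (src C s) \<otimes> e)"
    using s X arr e by (simp add: tensor_comp)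
qed (use s X iso_arr[OF e(1)] e in simp_all)

text \<open>The associator conjugates \<open>(s \<otimes> id\<^sub>X) \<otimes> id\<^sub>Y\<close> into \<open>s \<otimes> id\<^bsub>X \<otimes> Y\<^esub>\<close>.\<close>

lemma tensor_ident_iso_tensor:
  assumes s: "s \<in> mor C" and X: "is_iso C (s \<otimes> ident C X)" and obj: "X \<in> obj C" "Y \<in> obj C"
  shows "is_iso C (s \<otimes> ident C (X \<odot> Y))"
proof (rule iso_square_right)
  show "is_iso C ((s \<otimes> ident C X) \<otimes> ident C Y)"
    using X obj by (simp add: iso_tensor iso_ident)
  show "is_iso C (associator C (tgt C s) X Y)" "is_iso C (associator C (src C s) X Y)"
    using s obj by (simp_all add: associator_iso)
  show "associator C (tgt C s) X Y \<cdot> ((s \<otimes> ident C X) \<otimes> ident C Y)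
      = (s \<otimes> ident C (X \<odot> Y)) \<cdot> associator C (src C s) X Y"
    using associator_natural[of s "src C s" "tgt C s" "ident C X" X X "ident C Y" Y Y] s obj
    by (simp add: hom_def)
qed (use s obj in simp_all)

abbreviation subunit_meet :: "'m \<Rightarrow> 'm \<Rightarrow> 'm" where
  "subunit_meet s t \<equiv> left_unitor C \<one> \<cdot> (s \<otimes> t)"

text \<open>Apply \<open>s\<close> before \<open>t\<close> in \<open>s \<otimes> t\<close> and slide \<open>t\<close> past the left unitor. For \<open>s = t = u\<close> this
  exhibits \<open>u \<and> u\<close> as \<open>u\<close> preceded by \<open>\<lambda>\<^sub>U \<cdot> (u \<otimes> id\<^sub>U)\<close>, which is invertible when \<open>u\<close> is
  idempotent.\<close>

lemma subunit_meet_eq: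
  assumes arr: "s \<in> mor C" "t \<in> mor C" "tgt C s = \<one>" "tgt C t = \<one>"
  shows "subunit_meet s t = t \<cdot> left_unitor C (src C t) \<cdot> (s \<otimes> ident C (src C t))"
proof -
  have "s \<otimes> t = (ident C \<one> \<otimes> t) \<cdot> (s \<otimes> ident C (src C t))"
    using arr by (simp add: tensor_comp)
  moreover have "left_unitor C \<one> \<cdot> (ident C \<one> \<otimes> t) = t \<cdot> left_unitor C (src C t)"
    using left_unitor_natural[of t "src C t" \<one>] arr by (simp add: hom_def)
  moreover have "subunit_meet s t
      = (left_unitor C \<one> \<cdot> (ident C \<one> \<otimes> t)) \<cdot> (s \<otimes> ident C (src C t))"
    using arr calculation(1) by simp
  ultimately show ?thesis
    using arr by simp
qed

lemma subunit_meet_le_right: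
  assumes "s \<in> mor C" "t \<in> mor C" "tgt C s = \<one>" "tgt C t = \<one>"
  shows "factors_through C (subunit_meet s t) t"
  using assms subunit_meet_eq[OF assms]
  by (intro factors_throughI[where m = "left_unitor C (src C t) \<cdot> (s \<otimes> ident C (src C t))"])
    simp_all

lemma subunit_meet_monic:
  assumes firm: "firm C" and s: "s \<in> monos_into C \<one>" and t: "t \<in> monos_into C \<one>"
  shows "subunit_meet s t \<in> monos_into C \<one>"
proof -
  note arr = monos_intoD[OF s] monos_intoD[OF t]
  have "monic C (s \<otimes> ident C (src C t))"
    using firm s t by (simp add: firm_def)
  moreover have "monic C (left_unitor C (src C t))"
    using arr by (simp add: iso_monic left_unitor_iso)
  ultimately have "monic C (t \<cdot> left_unitor C (src C t) \<cdot> (s \<otimes> ident C (src C t)))"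
    using arr by (intro monic_comp) simp_all
  then show ?thesis
    using arr subunit_meet_eq[of s t] by (simp add: monos_into_def)
qed

text \<open>Split \<open>s \<otimes> t\<close> as \<open>id\<^sub>S \<otimes> t\<close> followed by \<open>s \<otimes> id\<^sub>I\<close>. After tensoring with \<open>X\<close>, the
  associator turns the first factor into \<open>id\<^sub>S \<otimes> (t \<otimes> id\<^sub>X)\<close> and the second into
  \<open>s \<otimes> id\<^bsub>I \<otimes> X\<^esub>\<close>, and \<open>I \<otimes> X \<cong> X\<close>.\<close>

lemma tensor_ident_iso_subunit_meet:
  assumes arr: "s \<in> mor C" "t \<in> mor C" "tgt C s = \<one>" "tgt C t = \<one>" and X: "X \<in> obj C"
    and sX: "is_iso C (s \<otimes> ident C X)" and tX: "is_iso C (t \<otimes> ident C X)"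
  shows "is_iso C (subunit_meet s t \<otimes> ident C X)"
proof -
  have t': "is_iso C ((ident C (src C s) \<otimes> t) \<otimes> ident C X)"
  proof (rule iso_square_left)
    show "is_iso C (ident C (src C s) \<otimes> (t \<otimes> ident C X))"
      using arr tX by (simp add: iso_tensor iso_ident)
    show "is_iso C (associator C (src C s) \<one> X)" "is_iso C (associator C (src C s) (src C t) X)"
      using arr X by (simp_all add: associator_iso)
    show "associator C (src C s) \<one> X \<cdot> ((ident C (src C s) \<otimes> t) \<otimes> ident C X)
        = (ident C (src C s) \<otimes> (t \<otimes> ident C X)) \<cdot> associator C (src C s) (src C t) X"
      using associator_natural[of "ident C (src C s)" "src C s" "src C s" t "src C t" \<one>
          "ident C X" X X] arr X
      by (simp add: hom_def)
  qed (use arr X in simp_all)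
  obtain e where e: "is_iso C e" "src C e = X" "tgt C e = \<one> \<odot> X"
    by (rule iso_inverse[OF left_unitor_iso[OF X] left_unitor_arr(2)[OF X] left_unitor_arr(3)[OF X]])
  have s': "is_iso C ((s \<otimes> ident C \<one>) \<otimes> ident C X)"
  proof (rule iso_square_left)
    show "is_iso C (s \<otimes> ident C (\<one> \<odot> X))"
      using tensor_ident_iso_transfer[OF arr(1) sX X e(1,2)] e(3) by simp
    show "is_iso C (associator C \<one> \<one> X)" "is_iso C (associator C (src C s) \<one> X)"
      using arr X by (simp_all add: associator_iso)
    show "associator C \<one> \<one> X \<cdot> ((s \<otimes> ident C \<one>) \<otimes> ident C X)
        = (s \<otimes> ident C (\<one> \<odot> X)) \<cdot> associator C (src C s) \<one> X"
      using associator_natural[of s "src C s" \<one> "ident C \<one>" \<one> \<one> "ident C X" X X] arr X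
      by (simp add: hom_def)
  qed (use arr X in simp_all)
  have "subunit_meet s t \<otimes> ident C X = (left_unitor C \<one> \<otimes> ident C X)
      \<cdot> ((s \<otimes> ident C \<one>) \<otimes> ident C X) \<cdot> ((ident C (src C s) \<otimes> t) \<otimes> ident C X)"
    using arr X by (simp add: tensor_comp)
  moreover have "is_iso C (left_unitor C \<one> \<otimes> ident C X)"
    using X by (simp add: iso_tensor iso_ident left_unitor_iso)
  ultimately show ?thesis
    using s' t' arr X by (simp add: iso_comp)
qed

lemma idempotentD:
  assumes "idempotent_subunit C s"
  shows "s \<in> monos_into C \<one>" "monic C s" "s \<in> mor C" "tgt C s = \<one>"
    "is_iso C (s \<otimes> ident C (src C s))"
  using assms monos_intoD[of s \<one>] by (auto simp: idempotent_subunit_def)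

text \<open>Idempotence of \<open>u\<close> supplies a diagonal \<open>U \<rightarrow> U \<otimes> U\<close>, along which the two factorisations
  combine.\<close>

lemma le_subunit_meet:
  assumes u: "idempotent_subunit C u" and s: "s \<in> mor C" "tgt C s = \<one>" "factors_through C u s"
    and t: "t \<in> mor C" "tgt C t = \<one>" "factors_through C u t"
  shows "factors_through C u (subunit_meet s t)"
proof -
  let ?U = "src C u"
  note arr = idempotentD(3,4)[OF u] s(1,2) t(1,2)
  obtain m where m: "m \<in> mor C" "src C m = ?U" "tgt C m = src C s" "s \<cdot> m = u"
    by (rule factors_throughE[OF s(3)])
  obtain n where n: "n \<in> mor C" "src C n = ?U" "tgt C n = src C t" "t \<cdot> n = u"
    by (rule factors_throughE[OF t(3)])
  let ?\<sigma> = "left_unitor C ?U \<cdot> (u \<otimes> ident C ?U)"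
  have "is_iso C ?\<sigma>" "src C ?\<sigma> = ?U \<odot> ?U" "tgt C ?\<sigma> = ?U"
    using arr idempotentD(5)[OF u] by (simp_all add: iso_comp left_unitor_iso)
  then obtain \<delta> where \<delta>: "is_iso C \<delta>" "src C \<delta> = ?U" "tgt C \<delta> = ?U \<odot> ?U"
      "?\<sigma> \<cdot> \<delta> = ident C ?U"
    by (rule iso_inverse)
  note arr = arr m(1-3) n(1-3) iso_arr[OF \<delta>(1)] \<delta>(2,3)
  have "subunit_meet s t \<cdot> (m \<otimes> n) \<cdot> \<delta> = left_unitor C \<one> \<cdot> ((s \<otimes> t) \<cdot> (m \<otimes> n)) \<cdot> \<delta>"
    using arr by simp
  also have "\<dots> = subunit_meet u u \<cdot> \<delta>"
    using arr m(4) n(4) by (simp add: tensor_comp)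
  also have "\<dots> = u \<cdot> ?\<sigma> \<cdot> \<delta>"
    using arr by (subst subunit_meet_eq) simp_all
  also have "\<dots> = u"
    using arr \<delta>(4) by simp
  finally show ?thesis
    using arr by (intro factors_throughI[where m = "(m \<otimes> n) \<cdot> \<delta>"]) simp_all
qed

end

context braided_monoidal_category
begin

lemma braiding_arr [simp]:
  assumes "A \<in> obj C" "B \<in> obj C"
  shows "braiding C A B \<in> mor C" "src C (braiding C A B) = A \<odot> B" "tgt C (braiding C A B) = B \<odot> A"
  using braiding_hom[OF assms] by (simp_all add: hom_def)

text \<open>The braiding is what lets \<open>t\<close> absorb \<open>S \<otimes> T\<close>, where its own domain is the second factor.\<close>

lemma subunit_meet_idempotent:
  assumes firm: "firm C" and s: "idempotent_subunit C s" and t: "idempotent_subunit C t"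
  shows "idempotent_subunit C (subunit_meet s t)"
proof -
  let ?S = "src C s" and ?T = "src C t"
  note arr = idempotentD(3,4)[OF s] idempotentD(3,4)[OF t]
  have "is_iso C (s \<otimes> ident C (?S \<odot> ?T))"
    using arr idempotentD(5)[OF s] by (simp add: tensor_ident_iso_tensor)
  moreover have "is_iso C (t \<otimes> ident C (?T \<odot> ?S))"
    using arr idempotentD(5)[OF t] by (simp add: tensor_ident_iso_tensor)
  then have "is_iso C (t \<otimes> ident C (?S \<odot> ?T))"
    using tensor_ident_iso_transfer[of t "?T \<odot> ?S" "braiding C ?T ?S"] arr
    by (simp add: braiding_iso)
  ultimately have "is_iso C (subunit_meet s t \<otimes> ident C (?S \<odot> ?T))"
    using arr by (simp add: tensor_ident_iso_subunit_meet)
  then show ?thesis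
    using arr subunit_meet_monic[OF firm idempotentD(1)[OF s] idempotentD(1)[OF t]]
    by (simp add: idempotent_subunit_def)
qed

text \<open>The heart of the argument is the factorisation \<open>s \<otimes> id\<^sub>I = (s \<otimes> s) \<cdot> m\<close>. It follows by writing
  \<open>s \<otimes> id\<^sub>I\<close> as \<open>\<beta>\<^sup>-\<^sup>1 \<cdot> (id\<^sub>I \<otimes> s) \<cdot> \<beta>\<close>, replacing the middle factor by \<open>(s \<otimes> s) \<cdot> \<epsilon>\<close>
  with \<open>\<epsilon> = (s \<otimes> id\<^sub>S)\<^sup>-\<^sup>1\<close>, and moving \<open>\<beta>\<^sup>-\<^sup>1\<close> past \<open>s \<otimes> s\<close> by naturality. Then
  \<open>s \<and> t \<le> s \<and> s\<close>, and \<open>s \<and> s \<le> s\<close> because \<open>s\<close> is also the second factor.\<close>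

lemma subunit_meet_le_left:
  assumes s: "idempotent_subunit C s" and t: "t \<in> mor C" "tgt C t = \<one>"
  shows "factors_through C (subunit_meet s t) s"
proof -
  let ?S = "src C s"
  note arr = idempotentD(3,4)[OF s] t
  have S: "?S \<in> obj C" using arr by simp
  obtain \<gamma> where \<gamma>: "is_iso C \<gamma>" "src C \<gamma> = \<one> \<odot> \<one>" "tgt C \<gamma> = \<one> \<odot> \<one>"
      "\<gamma> \<cdot> braiding C \<one> \<one> = ident C (\<one> \<odot> \<one>)"
    by (rule iso_inverse[OF braiding_iso[OF unit_obj unit_obj]
          braiding_arr(2)[OF unit_obj unit_obj]
          braiding_arr(3)[OF unit_obj unit_obj]])
  obtain \<gamma>' where \<gamma>': "is_iso C \<gamma>'" "src C \<gamma>' = ?S \<odot> ?S" "tgt C \<gamma>' = ?S \<odot> ?S"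
      "braiding C ?S ?S \<cdot> \<gamma>' = ident C (?S \<odot> ?S)"
    by (rule iso_inverse[OF braiding_iso[OF S S] braiding_arr(2)[OF S S] braiding_arr(3)[OF S S]])
  have "src C (s \<otimes> ident C ?S) = ?S \<odot> ?S" "tgt C (s \<otimes> ident C ?S) = \<one> \<odot> ?S"
    using arr by simp_all
  then obtain \<epsilon> where \<epsilon>: "is_iso C \<epsilon>" "src C \<epsilon> = \<one> \<odot> ?S" "tgt C \<epsilon> = ?S \<odot> ?S"
      "(s \<otimes> ident C ?S) \<cdot> \<epsilon> = ident C (\<one> \<odot> ?S)"
    by (rule iso_inverse[OF idempotentD(5)[OF s]])
  note arr = arr iso_arr[OF \<gamma>(1)] \<gamma>(2,3) iso_arr[OF \<gamma>'(1)] \<gamma>'(2,3) iso_arr[OF \<epsilon>(1)] \<epsilon>(2,3)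
  \<comment> \<open>naturality of the inverse braiding, restricted to the one square needed\<close>
  have nat: "\<gamma> \<cdot> (s \<otimes> s) = (s \<otimes> s) \<cdot> \<gamma>'"
  proof -
    have "\<gamma> \<cdot> (s \<otimes> s) = \<gamma> \<cdot> (s \<otimes> s) \<cdot> (braiding C ?S ?S \<cdot> \<gamma>')"
      using arr \<gamma>'(4) by simp
    also have "\<dots> = \<gamma> \<cdot> ((s \<otimes> s) \<cdot> braiding C ?S ?S) \<cdot> \<gamma>'"
      using arr by simp
    also have "(s \<otimes> s) \<cdot> braiding C ?S ?S = braiding C \<one> \<one> \<cdot> (s \<otimes> s)"
      using braiding_natural[of s ?S \<one> s ?S \<one>] arr by (simp add: hom_def)
    also have "\<gamma> \<cdot> (braiding C \<one> \<one> \<cdot> (s \<otimes> s)) \<cdot> \<gamma>' = (\<gamma> \<cdot> braiding C \<one> \<one>) \<cdot> (s \<otimes> s) \<cdot> \<gamma>'"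
      using arr by simp
    also have "\<dots> = (s \<otimes> s) \<cdot> \<gamma>'"
      unfolding \<gamma>(4) using arr by simp
    finally show ?thesis .
  qed
  let ?m = "\<gamma>' \<cdot> \<epsilon> \<cdot> braiding C ?S \<one>"
  have "s \<otimes> ident C \<one> = (\<gamma> \<cdot> braiding C \<one> \<one>) \<cdot> (s \<otimes> ident C \<one>)"
    unfolding \<gamma>(4) using arr by simp
  also have "\<dots> = \<gamma> \<cdot> (braiding C \<one> \<one> \<cdot> (s \<otimes> ident C \<one>))"
    using arr by simp
  also have "braiding C \<one> \<one> \<cdot> (s \<otimes> ident C \<one>) = (ident C \<one> \<otimes> s) \<cdot> braiding C ?S \<one>"
    using braiding_natural[of s ?S \<one> "ident C \<one>" \<one> \<one>] arr by (simp add: hom_def)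
  also have "ident C \<one> \<otimes> s = (ident C \<one> \<otimes> s) \<cdot> ((s \<otimes> ident C ?S) \<cdot> \<epsilon>)"
    unfolding \<epsilon>(4) using arr by simp
  also have "\<dots> = ((ident C \<one> \<otimes> s) \<cdot> (s \<otimes> ident C ?S)) \<cdot> \<epsilon>"
    using arr by simp
  also have "(ident C \<one> \<otimes> s) \<cdot> (s \<otimes> ident C ?S) = s \<otimes> s"
    using arr by (simp add: tensor_comp)
  also have "\<gamma> \<cdot> ((s \<otimes> s) \<cdot> \<epsilon>) \<cdot> braiding C ?S \<one> = (\<gamma> \<cdot> (s \<otimes> s)) \<cdot> \<epsilon> \<cdot> braiding C ?S \<one>"
    using arr by simp
  also have "\<dots> = (s \<otimes> s) \<cdot> ?m"
    unfolding nat using arr by simp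
  finally have key: "s \<otimes> ident C \<one> = (s \<otimes> s) \<cdot> ?m" .
  have "subunit_meet s t = left_unitor C \<one> \<cdot> ((s \<otimes> ident C \<one>) \<cdot> (ident C ?S \<otimes> t))"
    using arr by (simp add: tensor_comp)
  also have "\<dots> = subunit_meet s s \<cdot> (?m \<cdot> (ident C ?S \<otimes> t))"
    unfolding key using arr by simp
  finally have "factors_through C (subunit_meet s t) (subunit_meet s s)"
    using arr by (intro factors_throughI[where m = "?m \<cdot> (ident C ?S \<otimes> t)"]) simp_all
  then show ?thesis
    using subunit_meet_le_right[of s s] arr
    by - (rule factors_through_trans[of _ "subunit_meet s s"], simp_all)
qed

end

section \<open>The semilattice of idempotent subunits\<close>

context monoidal_category
begin

lemma ident_idempotent: "idempotent_subunit C (ident C \<one>)"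
  by (simp add: idempotent_subunit_def monos_into_def iso_monic iso_ident)

lemma ISub_simps:
  "carrier (ISub C) = idempotent_subunits C" "X .=\<^bsub>ISub C\<^esub> Y \<longleftrightarrow> X = Y"
  "X \<sqsubseteq>\<^bsub>ISub C\<^esub> Y \<longleftrightarrow> subobj_le C X Y"
  by (simp_all add: ISub_def)

text \<open>An idempotent class need only contain one idempotent representative, so that representative can
  be chosen to name the class; all order questions then reduce to factorisations of arrows.\<close>

lemma idempotent_subunits_eq:
  "idempotent_subunits C = subobj_class C ` {s. idempotent_subunit C s}"
proof (intro equalityI subsetI)
  fix X assume "X \<in> idempotent_subunits C"
  then obtain s where X: "X \<in> monos_into C \<one> // subobj_rel C \<one>" and s: "s \<in> X" "idempotent_subunit C s"
    by (auto simp: idempotent_subunits_def subobjects_def)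
  obtain t where "X = subobj_rel C \<one> `` {t}"
    using X by (rule quotientE)
  then have "X = subobj_rel C \<one> `` {s}"
    using s(1) equiv_class_eq[OF equiv_subobj_rel, of t s \<one>] by simp
  then have "X = subobj_class C s"
    using idempotentD(4)[OF s(2)] by (simp add: subobj_class_def)
  then show "X \<in> subobj_class C ` {s. idempotent_subunit C s}"
    using s(2) by (intro image_eqI) simp_all
next
  fix X assume "X \<in> subobj_class C ` {s. idempotent_subunit C s}"
  then obtain s where s: "idempotent_subunit C s" and X: "X = subobj_class C s" by auto
  have "s \<in> X"
    using idempotentD[OF s] by (simp add: X mem_subobj_class_iff factors_through_refl)
  moreover have "X \<in> subobjects C \<one>"
    using idempotentD[OF s] by (simp add: X subobj_class_def subobjects_def quotientI)
  ultimately show "X \<in> idempotent_subunits C"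
    using s by (auto simp: idempotent_subunits_def)
qed

lemma ISub_cases:
  assumes "X \<in> carrier (ISub C)"
  obtains s where "idempotent_subunit C s" "X = subobj_class C s"
  using assms by (auto simp: ISub_simps idempotent_subunits_eq)

lemma class_in_ISub: "idempotent_subunit C s \<Longrightarrow> subobj_class C s \<in> carrier (ISub C)"
  by (auto simp: ISub_simps idempotent_subunits_eq)

lemma ISub_le_iff:
  "\<lbrakk>idempotent_subunit C s; idempotent_subunit C t\<rbrakk>
    \<Longrightarrow> subobj_class C s \<sqsubseteq>\<^bsub>ISub C\<^esub> subobj_class C t \<longleftrightarrow> factors_through C s t"
  by (simp add: ISub_simps subobj_class_le_iff[OF idempotentD(1) idempotentD(1)])

lemma ISub_partial_order: "partial_order (ISub C)"
proof
  fix X assume "X \<in> carrier (ISub C)"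
  then obtain s where "idempotent_subunit C s" "X = subobj_class C s" by (rule ISub_cases)
  then show "X \<sqsubseteq>\<^bsub>ISub C\<^esub> X"
    by (simp add: ISub_le_iff idempotentD factors_through_refl)
next
  fix X Y assume le: "X \<sqsubseteq>\<^bsub>ISub C\<^esub> Y" "Y \<sqsubseteq>\<^bsub>ISub C\<^esub> X"
    and X: "X \<in> carrier (ISub C)" and Y: "Y \<in> carrier (ISub C)"
  obtain s where s: "idempotent_subunit C s" "X = subobj_class C s"
    using X by (rule ISub_cases)
  obtain t where t: "idempotent_subunit C t" "Y = subobj_class C t"
    using Y by (rule ISub_cases)
  have "X = Y"
    using le s t subobj_class_eqI[OF idempotentD(1)[OF s(1)] idempotentD(1)[OF t(1)]]
    by (simp add: ISub_le_iff)
  then show "X .=\<^bsub>ISub C\<^esub> Y" by (simp add: ISub_simps)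
next
  fix X Y Z assume le: "X \<sqsubseteq>\<^bsub>ISub C\<^esub> Y" "Y \<sqsubseteq>\<^bsub>ISub C\<^esub> Z"
    and X: "X \<in> carrier (ISub C)" and Y: "Y \<in> carrier (ISub C)" and Z: "Z \<in> carrier (ISub C)"
  obtain r where r: "idempotent_subunit C r" "X = subobj_class C r"
    using X by (rule ISub_cases)
  obtain s where s: "idempotent_subunit C s" "Y = subobj_class C s"
    using Y by (rule ISub_cases)
  obtain t where t: "idempotent_subunit C t" "Z = subobj_class C t"
    using Z by (rule ISub_cases)
  show "X \<sqsubseteq>\<^bsub>ISub C\<^esub> Z"
    using le r s t factors_through_trans[of r s t] by (simp add: ISub_le_iff idempotentD(3))
qed (auto simp: ISub_simps fun_eq_iff)

lemma ISub_greatest: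
  "greatest (ISub C) (subobj_class C (ident C \<one>)) (carrier (ISub C))"
  unfolding greatest_def
proof (intro conjI ballI)
  fix X assume "X \<in> carrier (ISub C)"
  then obtain s where s: "idempotent_subunit C s" "X = subobj_class C s" by (rule ISub_cases)
  have "factors_through C s (ident C \<one>)"
    using idempotentD[OF s(1)] by (intro factors_throughI[where m = s]) simp_all
  then show "X \<sqsubseteq>\<^bsub>ISub C\<^esub> subobj_class C (ident C \<one>)"
    using s by (simp add: ISub_le_iff ident_idempotent)
qed (simp_all add: class_in_ISub ident_idempotent)

end

context braided_monoidal_category
begin

text \<open>If \<open>s \<le> t\<close>, then \<open>s \<le> s \<and> t \<le> s\<close>, and the comparison map between these two monomorphisms is
  the required isomorphism.\<close>

lemma idempotent_le_iff:
  assumes firm: "firm C" and s: "idempotent_subunit C s" and t: "idempotent_subunit C t"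
  shows "factors_through C s t \<longleftrightarrow>
    (\<exists>h \<in> hom C (src C s) (src C s \<odot> src C t). is_iso C h \<and> subunit_meet s t \<cdot> h = s)"
proof
  note arr = idempotentD(3,4)[OF s] idempotentD(3,4)[OF t]
  note meet = idempotentD(2)[OF subunit_meet_idempotent[OF firm s t]]
  assume "factors_through C s t"
  then have le: "factors_through C s (subunit_meet s t)"
    using arr s by (intro le_subunit_meet) (simp_all add: factors_through_refl)
  have ge: "factors_through C (subunit_meet s t) s"
    using arr s by (intro subunit_meet_le_left)
  obtain h where "is_iso C h" "src C h = src C s" "tgt C h = src C (subunit_meet s t)"
      "subunit_meet s t \<cdot> h = s"
    by (rule mutual_factors_iso[OF idempotentD(2)[OF s] meet le ge])
  then show "\<exists>h \<in> hom C (src C s) (src C s \<odot> src C t). is_iso C h \<and> subunit_meet s t \<cdot> h = s"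
    using arr by (intro bexI[of _ h]) (auto simp: hom_def iso_arr)
next
  note arr = idempotentD(3,4)[OF s] idempotentD(3,4)[OF t]
  assume "\<exists>h \<in> hom C (src C s) (src C s \<odot> src C t). is_iso C h \<and> subunit_meet s t \<cdot> h = s"
  then have "factors_through C s (subunit_meet s t)"
    using arr by (auto simp: factors_through_def)
  then show "factors_through C s t"
    using subunit_meet_le_right[of s t] arr
    by - (rule factors_through_trans[of _ "subunit_meet s t"], simp_all)
qed

lemma ISub_greatest_lower_bound:
  assumes firm: "firm C" and s: "idempotent_subunit C s" and t: "idempotent_subunit C t"
  shows "greatest (ISub C) (subobj_class C (subunit_meet s t))
    (Lower (ISub C) {subobj_class C s, subobj_class C t})"
proof -
  note meet = subunit_meet_idempotent[OF firm s t]
  note arr = idempotentD(3,4)[OF s] idempotentD(3,4)[OF t]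
  show ?thesis
  proof (rule greatest_LowerI)
    fix X assume "X \<in> {subobj_class C s, subobj_class C t}"
    then show "subobj_class C (subunit_meet s t) \<sqsubseteq>\<^bsub>ISub C\<^esub> X"
      using arr s t meet by (auto simp: ISub_le_iff subunit_meet_le_left subunit_meet_le_right)
  next
    fix X assume X: "X \<in> Lower (ISub C) {subobj_class C s, subobj_class C t}"
    then obtain u where u: "idempotent_subunit C u" "X = subobj_class C u"
      by (auto simp: Lower_def elim: ISub_cases)
    have "factors_through C u s" "factors_through C u t"
      using X s t u class_in_ISub by (auto simp: Lower_def ISub_le_iff)
    then show "X \<sqsubseteq>\<^bsub>ISub C\<^esub> subobj_class C (subunit_meet s t)"
      using arr u meet by (simp add: ISub_le_iff le_subunit_meet)
  qed (use s t meet in \<open>auto simp: class_in_ISub\<close>)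
qed

lemma ISub_lower_semilattice:
  assumes firm: "firm C"
  shows "lower_semilattice (ISub C)"
proof -
  interpret partial_order "ISub C" by (rule ISub_partial_order)
  show ?thesis
  proof
    fix X Y assume "X \<in> carrier (ISub C)" "Y \<in> carrier (ISub C)"
    then obtain s t where "idempotent_subunit C s" "X = subobj_class C s"
        "idempotent_subunit C t" "Y = subobj_class C t"
      by (elim ISub_cases)
    then show "\<exists>Z. greatest (ISub C) Z (Lower (ISub C) {X, Y})"
      using ISub_greatest_lower_bound[OF firm] by blast
  qed
qed

lemma ISub_meet:
  assumes firm: "firm C" and s: "idempotent_subunit C s" and t: "idempotent_subunit C t"
  shows "subobj_class C s \<sqinter>\<^bsub>ISub C\<^esub> subobj_class C t = subobj_class C (subunit_meet s t)"
proof -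
  interpret partial_order "ISub C" by (rule ISub_partial_order)
  note glb = ISub_greatest_lower_bound[OF firm s t]
  show ?thesis
    unfolding meet_def inf_def
    by (rule some_equality, rule glb, rule greatest_unique[OF _ glb])
qed

end

theorem corollary11:
  fixes C :: "('o, 'm, 'e) braided_monoidal_category_scheme" (structure)
  assumes "braided_monoidal_category C"
    and "firm C"
  shows "lower_semilattice (ISub C)
    \<and> (\<forall>s t. idempotent_subunit C s \<and> idempotent_subunit C t \<longrightarrow>
          idempotent_subunit C (left_unitor C \<one> \<cdot> (s \<otimes> t))
        \<and> subobj_class C s \<sqinter>\<^bsub>ISub C\<^esub> subobj_class C t
            = subobj_class C (left_unitor C \<one> \<cdot> (s \<otimes> t)))
    \<and> idempotent_subunit C (ident C \<one>)
    \<and> greatest (ISub C) (subobj_class C (ident C \<one>)) (carrier (ISub C))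
    \<and> (\<forall>s t. idempotent_subunit C s \<and> idempotent_subunit C t \<longrightarrow>
          (factors_through C s t \<longleftrightarrow>
            (\<exists>h \<in> hom C (src C s) (src C s \<odot> src C t).
               is_iso C h \<and> (left_unitor C \<one> \<cdot> (s \<otimes> t)) \<cdot> h = s)))"
proof -
  interpret braided_monoidal_category C by (rule assms(1))
  show ?thesis
    by (intro conjI allI impI ISub_lower_semilattice ISub_greatest ident_idempotent
        subunit_meet_idempotent ISub_meet idempotent_le_iff assms(2)) (elim conjE, assumption)+
qed

end
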